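(* For all $p', p'' \in [0,1]$ satisfying $|p'-\frac12|>|p''-\frac12|$, we have $(|V_n^{p''}|)_{n\geq 0} \preceq_{st} (|V_n^{p'}|)_{n\geq 0}$. Consequently, $(|V_n^{p}|)_{n\geq 0}$ is stochastically decreasing in $p \in [0,\frac12]$ and increasing in $p \in [\frac12,1]$ (with respect to $\preceq_{st}$).
   Context: For $p\in[0,1]$, let $X_1^p,X_2^p,\dots$ be i.i.d. with $P(X_n^p=1)=p$ and $P(X_n^p=-1)=1-p$, and let $X_0\in\{+1,-1\}$ be independent of $X_1^p,X_2^p,\dots$ with $P(X_0=1)=P(X_0=-1)=\frac12$. Set $V_0^p=X_0$ and $V_n^p=X_0+2X_1^p+\cdots+2X_n^p$ for $n\ge1$. Stochastic order: for infinite-dimensional random vectors $\mathbf U=(U_n)_{n\ge0}$ and $\mathbf V=(V_n)_{n\ge0}$ (random elements of $\mathbb R^\infty$ with the product topology and its Borel $\sigma$-field), $\mathbf U\preceq_{st}\mathbf V$ means $E f(\mathbf U)\le E f(\mathbf V)$ for all bounded increasing measurable $f:\mathbb R^\infty\to\mathbb R$, where $f$ is increasing if $f(x_0,x_1,\dots)\le f(y_0,y_1,\dots)$ whenever $x_i\le y_i$ for all $i$. The random vectors need not be defined on the same probability space. "Increasing" and "decreasing" are meant in the non-strict sense. *)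

theory Defs
  imports "HOL-Probability.Probability"
begin

text \<open>Only the steps \<open>X n\<close> with \<open>n \<ge> 1\<close> are used; \<open>X 0\<close> is unconstrained. The random
  variables take their values in \<open>{1, -1}\<close> almost surely, since the stated probabilities
  add up to one. The last assumption says that the \<open>\<sigma>\<close>-algebras generated by \<open>X0\<close> and by
  the whole sequence \<open>X 1, X 2, \<dots>\<close> are independent; \<^const>\<open>prob_space.indep_var\<close> would
  require both variables to have the same type of values.\<close>

locale signed_steps = prob_space M for M :: "'a measure" +
  fixes p :: real and X0 :: "'a \<Rightarrow> real" and X :: "nat \<Rightarrow> 'a \<Rightarrow> real"
  assumes indep_steps: "indep_vars (\<lambda>_. borel) X {1..}"
    and step_up: "\<And>n. n \<ge> 1 \<Longrightarrow> prob {\<omega> \<in> space M. X n \<omega> = 1} = p"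
    and step_down: "\<And>n. n \<ge> 1 \<Longrightarrow> prob {\<omega> \<in> space M. X n \<omega> = -1} = 1 - p"
    and start_up: "prob {\<omega> \<in> space M. X0 \<omega> = 1} = 1 / 2"
    and start_down: "prob {\<omega> \<in> space M. X0 \<omega> = -1} = 1 / 2"
    and start_measurable: "random_variable borel X0"
    and indep_start:
      "indep_set (sets (vimage_algebra (space M) X0 borel))
         (sets (vimage_algebra (space M) (\<lambda>\<omega> n. X (Suc n) \<omega>) borel))"

definition walk :: "('a \<Rightarrow> real) \<Rightarrow> (nat \<Rightarrow> 'a \<Rightarrow> real) \<Rightarrow> nat \<Rightarrow> 'a \<Rightarrow> real" where
  "walk X0 X n \<omega> = X0 \<omega> + 2 * (\<Sum>k = 1..n. X k \<omega>)"

definition abs_walk :: "('a \<Rightarrow> real) \<Rightarrow> (nat \<Rightarrow> 'a \<Rightarrow> real) \<Rightarrow> 'a \<Rightarrow> nat \<Rightarrow> real" where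
  "abs_walk X0 X \<omega> = (\<lambda>n. \<bar>walk X0 X n \<omega>\<bar>)"

text \<open>On \<open>nat \<Rightarrow> real\<close>, \<open>borel\<close> is the Borel \<open>\<sigma>\<close>-algebra of the product topology, and
  \<open>mono\<close> refers to the coordinatewise order.\<close>

definition stoch_le ::
  "'a measure \<Rightarrow> ('a \<Rightarrow> nat \<Rightarrow> real) \<Rightarrow> 'b measure \<Rightarrow> ('b \<Rightarrow> nat \<Rightarrow> real) \<Rightarrow> bool" where
  "stoch_le M U N V \<longleftrightarrow>
     prob_space M \<and> U \<in> M \<rightarrow>\<^sub>M borel \<and> prob_space N \<and> V \<in> N \<rightarrow>\<^sub>M borel \<and>
     (\<forall>f :: (nat \<Rightarrow> real) \<Rightarrow> real.
        f \<in> borel \<rightarrow>\<^sub>M borel \<and> bounded (range f) \<and> mono f \<longrightarrow>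
        (\<integral>\<omega>. f (U \<omega>) \<partial>M) \<le> (\<integral>\<omega>. f (V \<omega>) \<partial>N))"

end

theory Submission
  imports Defs
begin

text \<open>
  Write \<open>q = 1 - p\<close> and \<open>|V n| = 2 * Z n + 1\<close>. Although \<open>|V|\<close> forgets the sign of the walk, the
  level \<open>Z\<close> is a Markov chain, inhomogeneous in time. A path of \<open>Z\<close> up to time \<open>n\<close> comes from
  exactly two paths of \<open>V\<close>, mirror images of each other, with equal probabilities of their
  starting points and with the ratio \<open>p ^ g : q ^ g\<close> of the probabilities of their steps, where
  \<open>g\<close> is the surplus of one kind of steps over the other. The surplus depends on the level, and
  on the parity of the number of sign changes; but at time \<open>n\<close> and level \<open>j\<close> that parity is the
  one of \<open>n + j\<close>, so \<open>g = j + (n + j) mod 2\<close>. Hence the conditional probability of going up is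
  \<open>a g = (p ^ (g + 1) + q ^ (g + 1)) / (p ^ g + q ^ g)\<close>.

  These numbers satisfy \<open>a 0 = 1 / 2\<close> and \<open>a (g + 1) = 1 - p * q / a g\<close>. By induction, \<open>a g\<close> increases
  with \<open>g\<close> and decreases with \<open>p * q = 1 / 4 - (p - 1 / 2)\<^sup>2\<close>, that is, it increases with
  \<open>|p - 1 / 2|\<close>. At a fixed time \<open>g\<close> is an increasing function of \<open>j\<close>, since the parity
  correction is at most one. So if the chains for two parameters are driven by the same sequence
  of uniform random numbers, the one with the parameter further from \<open>1 / 2\<close> always has the larger
  probability of going up as long as it is not below the other, and it therefore never falls
  below the other (\<open>level_antimono\<close>). This coupling of the two laws gives the stochastic order.

  The lemmas \<open>prob_signed_path\<close> and \<open>level_of_coins_chain\<close> find the transition probabilities,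
  \<open>level_chain\<close> shows that the coupled paths have the same ones, and
  \<open>birth_death_chain_law_unique\<close> concludes that the laws on the space of infinite paths agree.
\<close>

section \<open>The probability that the absolute value goes up\<close>

text \<open>\<open>rise c g\<close> is \<open>(p ^ (g + 1) + q ^ (g + 1)) / (p ^ g + q ^ g)\<close> for \<open>p, q \<ge> 0\<close>
  with \<open>p + q = 1\<close> and \<open>c = p * q\<close> (\<open>rise_power_sum\<close> below). The recursion is used as the definition because it
  involves \<open>p\<close> only through \<open>c\<close> and yields both monotonicity properties by induction.\<close>

fun rise :: "real \<Rightarrow> nat \<Rightarrow> real" where
  "rise c 0 = 1 / 2"
| "rise c (Suc g) = 1 - c / rise c g"

lemma rise_bounds:
  assumes "0 \<le> c" "c \<le> 1 / 4"
  shows "1 / 2 \<le> rise c g \<and> rise c g \<le> 1"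
proof (induction g)
  case (Suc g)
  have "c / rise c g \<le> (1 / 4) / (1 / 2)"
    using Suc assms by (intro frac_le) auto
  moreover have "0 \<le> c / rise c g"
    using Suc assms by simp
  ultimately show ?case by simp
qed simp

lemma rise_antimono_product:
  assumes "0 \<le> c'" "c' \<le> c''" "c'' \<le> 1 / 4"
  shows "rise c'' g \<le> rise c' g"
proof (induction g)
  case (Suc g)
  have "c' / rise c' g \<le> c'' / rise c'' g"
    using Suc rise_bounds[of c'' g] assms by (intro frac_le) auto
  then show ?case by simp
qed simp

lemma rise_mono_excess:
  assumes c: "0 \<le> c" "c \<le> 1 / 4" and "g \<le> h"
  shows "rise c g \<le> rise c h"
proof -
  have "rise c g \<le> rise c (Suc g)" for g
  proof (induction g)
    case (Suc g)
    have "c / rise c (Suc g) \<le> c / rise c g"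
      using Suc rise_bounds[OF c, of g] c by (intro divide_left_mono) auto
    then show ?case by simp
  qed (use c in simp)
  then show ?thesis
    using \<open>g \<le> h\<close> by (rule lift_Suc_mono_le)
qed

lemma up_down_product_bounds:
  fixes p :: real
  assumes "0 \<le> p" "p \<le> 1"
  shows "0 \<le> p * (1 - p)" "p * (1 - p) \<le> 1 / 4"
proof -
  show "0 \<le> p * (1 - p)" using assms by simp
  show "p * (1 - p) \<le> 1 / 4"
    using zero_le_power2[of "p - 1 / 2"] by (simp add: power2_eq_square algebra_simps)
qed

text \<open>This identifies \<^const>\<open>rise\<close> as a ratio of power sums. With \<open>s g = p ^ g + (1 - p) ^ g\<close>,
  the recursion of \<^const>\<open>rise\<close> is the linear recurrence
  \<open>s (g + 2) = s (g + 1) - p * (1 - p) * s g\<close> divided by \<open>s (g + 1)\<close>.\<close>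

lemma rise_power_sum:
  assumes "0 \<le> p" "p \<le> 1"
  shows "rise (p * (1 - p)) g * (p ^ g + (1 - p) ^ g) = p ^ Suc g + (1 - p) ^ Suc g"
proof (induction g)
  case (Suc g)
  let ?r = "rise (p * (1 - p)) g" and ?s = "\<lambda>g. p ^ g + (1 - p) ^ g"
  have r: "?r > 0"
    using rise_bounds[OF up_down_product_bounds[OF assms], of g] by simp
  have "rise (p * (1 - p)) (Suc g) * ?s (Suc g) = ?s (Suc g) - p * (1 - p) * (?s (Suc g) / ?r)"
    by (simp add: left_diff_distrib del: power_Suc)
  also have "?s (Suc g) / ?r = ?s g"
    using Suc r by (simp add: field_simps)
  also have "?s (Suc g) - p * (1 - p) * ?s g = ?s (Suc (Suc g))"
    by (simp add: algebra_simps)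
  finally show ?case .
qed simp

text \<open>If \<open>|V n| = 2 * j + 1\<close>, then \<open>excess n j\<close> is the absolute value of the number of up-steps
  minus the number of down-steps among the first \<open>n\<close>. The summand \<open>(n + j) mod 2\<close> is the
  parity of the number of sign changes: a step changes \<open>j\<close> by one, or leaves \<open>j = 0\<close> unchanged
  and then changes the sign, so \<open>n + j\<close> and the number of sign changes have the same parity.\<close>

definition excess :: "nat \<Rightarrow> nat \<Rightarrow> nat" where
  "excess n j = j + (n + j) mod 2"

lemma excess_mono:
  assumes "i \<le> j"
  shows "excess n i \<le> excess n j"
proof (cases "i = j")
  case False
  have "(n + i) mod 2 < 2" by simp
  with False assms show ?thesis
    unfolding excess_def by linarith
qed simp

section \<open>The monotone coupling\<close>

text \<open>Starting from \<open>j = 0\<close>, a path driven by the numbers \<open>u n\<close>. Truncated subtraction makes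
  level \<open>0\<close> stay at \<open>0\<close> when it does not go up.\<close>

fun level :: "real \<Rightarrow> (nat \<Rightarrow> real) \<Rightarrow> nat \<Rightarrow> nat" where
  "level c u 0 = 0"
| "level c u (Suc n) =
     (if u n < rise c (excess n (level c u n)) then Suc (level c u n) else level c u n - 1)"

text \<open>Both paths use the same \<open>u\<close>. If one of them is at least as high as the other, its
  threshold for going up is at least as large, so it goes up whenever the lower one does, and
  both \<open>Suc\<close> and \<open>\<lambda>j. j - 1\<close> preserve the order. The comparison of thresholds is
  one at equal times, where the excess is monotone in the level.\<close>

lemma level_antimono:
  assumes c: "0 \<le> c'" "c' \<le> c''" "c'' \<le> 1 / 4"
  shows "level c'' u n \<le> level c' u n"
proof (induction n)
  case (Suc n)
  have "rise c'' (excess n (level c'' u n)) \<le> rise c' (excess n (level c'' u n))"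
    by (rule rise_antimono_product[OF c])
  also have "\<dots> \<le> rise c' (excess n (level c' u n))"
    using c by (intro rise_mono_excess excess_mono Suc.IH) auto
  finally show ?case using Suc by auto
qed simp

section \<open>Birth-death chains and their laws\<close>

text \<open>A process on the levels that starts at \<open>0\<close> and, given its whole past, goes up from
  level \<open>j\<close> at time \<open>n\<close> with probability \<open>r n j\<close>. The Markov property is expressed without
  conditioning, by the probabilities of finite paths. Truncated subtraction again lets the
  process stay at \<open>0\<close>.\<close>

locale birth_death_chain = prob_space M for M :: "'a measure" +
  fixes r :: "nat \<Rightarrow> nat \<Rightarrow> real" and Z :: "nat \<Rightarrow> 'a \<Rightarrow> nat"
  assumes chain_measurable [measurable]: "\<And>n. Z n \<in> M \<rightarrow>\<^sub>M count_space UNIV"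
    and chain_start: "\<And>\<omega>. \<omega> \<in> space M \<Longrightarrow> Z 0 \<omega> = 0"
    and chain_move: "\<And>n \<omega>. \<omega> \<in> space M \<Longrightarrow> Z (Suc n) \<omega> \<in> {Suc (Z n \<omega>), Z n \<omega> - 1}"
    and chain_up: "\<And>n l. prob {\<omega> \<in> space M. (\<forall>i\<le>n. Z i \<omega> = l i) \<and> Z (Suc n) \<omega> = Suc (l n)}
      = r n (l n) * prob {\<omega> \<in> space M. \<forall>i\<le>n. Z i \<omega> = l i}"
begin

lemma prob_path:
  "prob {\<omega> \<in> space M. \<forall>i\<le>n. Z i \<omega> = l i} =
    (if l 0 = 0 then 1 else 0) *
    (\<Prod>i<n. if l (Suc i) = Suc (l i) then r i (l i)
            else if l (Suc i) = l i - 1 then 1 - r i (l i) else 0)"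
proof (induction n)
  case 0
  have "{\<omega> \<in> space M. \<forall>i\<le>0. Z i \<omega> = l i} = (if l 0 = 0 then space M else {})"
    using chain_start by auto
  then show ?case by (simp add: prob_space)
next
  case (Suc n)
  let ?P = "{\<omega> \<in> space M. \<forall>i\<le>n. Z i \<omega> = l i}"
  let ?U = "{\<omega> \<in> space M. (\<forall>i\<le>n. Z i \<omega> = l i) \<and> Z (Suc n) \<omega> = Suc (l n)}"
  have S: "{\<omega> \<in> space M. \<forall>i\<le>Suc n. Z i \<omega> = l i} = {\<omega>\<in>?P. Z (Suc n) \<omega> = l (Suc n)}"
    by (auto simp: le_Suc_eq)
  have PU: "prob (?P - ?U) = prob ?P - prob ?U"
    by (rule finite_measure_Diff) auto
  consider "l (Suc n) = Suc (l n)" | "l (Suc n) \<noteq> Suc (l n)" "l (Suc n) = l n - 1"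
    | "l (Suc n) \<noteq> Suc (l n)" "l (Suc n) \<noteq> l n - 1" by blast
  then have "prob {\<omega> \<in> space M. \<forall>i\<le>Suc n. Z i \<omega> = l i} = prob ?P *
    (if l (Suc n) = Suc (l n) then r n (l n) else if l (Suc n) = l n - 1 then 1 - r n (l n) else 0)"
  proof cases
    case 1
    then have "{\<omega>\<in>?P. Z (Suc n) \<omega> = l (Suc n)} = ?U" by auto
    with 1 show ?thesis unfolding S by (simp add: chain_up)
  next
    case 2
    then have "{\<omega>\<in>?P. Z (Suc n) \<omega> = l (Suc n)} = ?P - ?U"
      using chain_move[of _ n] by fastforce
    with 2 show ?thesis unfolding S using PU by (simp add: chain_up algebra_simps)
  next
    case 3
    then have E: "{\<omega>\<in>?P. Z (Suc n) \<omega> = l (Suc n)} = {}"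
      using chain_move[of _ n] by fastforce
    from 3 show ?thesis unfolding S E by simp
  qed
  then show ?case using Suc by simp
qed

end

text \<open>A cylinder set in the path space is a countable disjoint union of finite paths, whose
  probabilities are products of values of \<open>r\<close> and \<open>1 - r\<close>.\<close>

lemma birth_death_chain_law_unique:
  assumes "birth_death_chain M r Z" and "birth_death_chain N r Y"
  shows "distr M (PiM UNIV (\<lambda>_. count_space UNIV)) (\<lambda>\<omega> n. Z n \<omega>) =
         distr N (PiM UNIV (\<lambda>_. count_space UNIV)) (\<lambda>\<omega> n. Y n \<omega>)" (is "?L = ?R")
proof -
  interpret Z: birth_death_chain M r Z by fact
  interpret Y: birth_death_chain N r Y by fact
  let ?P = "PiM UNIV (\<lambda>_::nat. count_space (UNIV::nat set))"
  have mZ[measurable]: "(\<lambda>\<omega> n. Z n \<omega>) \<in> M \<rightarrow>\<^sub>M ?P"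
    by (rule measurable_PiM_single') auto
  have mY[measurable]: "(\<lambda>\<omega> n. Y n \<omega>) \<in> N \<rightarrow>\<^sub>M ?P"
    by (rule measurable_PiM_single') auto
  show ?thesis
  proof (rule measure_eqI_PiM_infinite)
    show "finite_measure ?L"
      by (rule finite_measure.finite_measure_distr) (auto intro: Z.finite_measure_axioms)
  next
    fix A :: "nat \<Rightarrow> nat set" and J :: "nat set"
    assume "finite J" "J \<subseteq> UNIV"
    then obtain k where k: "J \<subseteq> {..k}"
      by (metis finite_nat_set_iff_bounded_le atMost_iff subsetI)
    \<comment> \<open>the possible values at the times \<open>0, ..., k\<close> for a path in the cylinder\<close>
    define I where "I = {xs. length xs = Suc k \<and> (\<forall>j\<in>J. xs ! j \<in> A j)}"
    have law: "emeasure (distr M' ?P (\<lambda>\<omega> n. X n \<omega>)) (prod_emb UNIV (\<lambda>_. count_space UNIV) J (Pi\<^sub>E J A))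
        = (\<integral>\<^sup>+ xs. ennreal ((if xs ! 0 = 0 then 1 else 0) *
            (\<Prod>i<k. if xs ! Suc i = Suc (xs ! i) then r i (xs ! i)
              else if xs ! Suc i = xs ! i - 1 then 1 - r i (xs ! i) else 0)) \<partial>count_space I)"
      if X: "birth_death_chain M' r X" and [measurable]: "(\<lambda>\<omega> n. X n \<omega>) \<in> M' \<rightarrow>\<^sub>M ?P"
      for M' :: "'c measure" and X
    proof -
      interpret X: birth_death_chain M' r X by fact
      have "emeasure (distr M' ?P (\<lambda>\<omega> n. X n \<omega>)) (prod_emb UNIV (\<lambda>_. count_space UNIV) J (Pi\<^sub>E J A))
          = emeasure M' ((\<lambda>\<omega> n. X n \<omega>) -` prod_emb UNIV (\<lambda>_. count_space UNIV) J (Pi\<^sub>E J A) \<inter> space M')"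
        using \<open>finite J\<close> by (intro emeasure_distr) (auto intro!: sets_PiM_I)
      also have "(\<lambda>\<omega> n. X n \<omega>) -` prod_emb UNIV (\<lambda>_. count_space UNIV) J (Pi\<^sub>E J A) \<inter> space M'
          = (\<Union>xs\<in>I. {\<omega>\<in>space M'. \<forall>i\<le>k. X i \<omega> = xs ! i})" (is "?E = ?F")
      proof (intro set_eqI iffI)
        fix \<omega> assume w: "\<omega> \<in> ?E"
        have "map (\<lambda>i. X i \<omega>) [0..<Suc k] \<in> I"
          using w k unfolding I_def by (auto simp: prod_emb_def Pi_iff simp del: upt_Suc)
        moreover have "\<forall>i\<le>k. X i \<omega> = map (\<lambda>i. X i \<omega>) [0..<Suc k] ! i"
          by (auto simp del: upt_Suc)
        ultimately show "\<omega> \<in> ?F" using w by blast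
      next
        fix \<omega> assume "\<omega> \<in> ?F"
        then show "\<omega> \<in> ?E" using k by (auto simp: prod_emb_def I_def Pi_iff PiE_iff)
      qed
      also have "emeasure M' ?F
          = (\<integral>\<^sup>+ xs. emeasure M' {\<omega>\<in>space M'. \<forall>i\<le>k. X i \<omega> = xs ! i} \<partial>count_space I)"
      proof (rule emeasure_UN_countable)
        show "disjoint_family_on (\<lambda>xs. {\<omega>\<in>space M'. \<forall>i\<le>k. X i \<omega> = xs ! i}) I"
          unfolding disjoint_family_on_def I_def by (auto simp: list_eq_iff_nth_eq less_Suc_eq_le)
      qed auto
      finally show ?thesis
        by (simp only: X.emeasure_eq_measure X.prob_path)
    qed
    show "emeasure ?L (prod_emb UNIV (\<lambda>_. count_space UNIV) J (Pi\<^sub>E J A))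
        = emeasure ?R (prod_emb UNIV (\<lambda>_. count_space UNIV) J (Pi\<^sub>E J A))"
      by (simp only: law[OF assms(1) mZ] law[OF assms(2) mY])
  qed simp_all
qed

text \<open>Both processes below are driven by an independent sequence. The next lemma supplies the
  Markov property for both: an event that depends on the members with index less than \<open>k\<close> is
  independent of the \<open>k\<close>th member.\<close>

lemma (in prob_space) prob_past_and_next:
  fixes Y :: "nat \<Rightarrow> 'a \<Rightarrow> 'b"
  assumes indep: "indep_vars N Y UNIV"
    and Q: "Measurable.pred (PiM {..<k} N) Q" and B: "B \<in> sets (N k)"
  shows "prob {\<omega> \<in> space M. Q (restrict (\<lambda>i. Y i \<omega>) {..<k}) \<and> Y k \<omega> \<in> B} =
    prob {\<omega> \<in> space M. Q (restrict (\<lambda>i. Y i \<omega>) {..<k})} * prob {\<omega> \<in> space M. Y k \<omega> \<in> B}"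
proof -
  have Y[measurable]: "random_variable (N i) (Y i)" for i
    using indep by (auto simp: indep_vars_def)
  have past: "restrict (\<lambda>i. Y i \<omega>) {..<k} \<in> space (PiM {..<k} N)" if "\<omega> \<in> space M" for \<omega>
    using measurable_space[OF Y that] by (auto simp: space_PiM)
  have now: "restrict (\<lambda>i. Y i \<omega>) {k} \<in> space (PiM {k} N)" if "\<omega> \<in> space M" for \<omega>
    using measurable_space[OF Y that] by (auto simp: space_PiM)
  have "indep_var (PiM {..<k} N) (\<lambda>\<omega>. restrict (\<lambda>i. Y i \<omega>) {..<k})
      (PiM {k} N) (\<lambda>\<omega>. restrict (\<lambda>i. Y i \<omega>) {k})"
    by (rule indep_var_restrict[OF indep]) auto
  moreover have "{f \<in> space (PiM {..<k} N). Q f} \<in> sets (PiM {..<k} N)"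
    using Q by measurable
  moreover have "{f \<in> space (PiM {k} N). f k \<in> B} \<in> sets (PiM {k} N)"
    using B by measurable
  ultimately have "prob ((\<lambda>\<omega>. (restrict (\<lambda>i. Y i \<omega>) {..<k}, restrict (\<lambda>i. Y i \<omega>) {k})) -`
      ({f \<in> space (PiM {..<k} N). Q f} \<times> {f \<in> space (PiM {k} N). f k \<in> B}) \<inter> space M) =
    prob ((\<lambda>\<omega>. restrict (\<lambda>i. Y i \<omega>) {..<k}) -` {f \<in> space (PiM {..<k} N). Q f} \<inter> space M) *
    prob ((\<lambda>\<omega>. restrict (\<lambda>i. Y i \<omega>) {k}) -` {f \<in> space (PiM {k} N). f k \<in> B} \<inter> space M)"
    by (rule indep_varD)
  also have "(\<lambda>\<omega>. (restrict (\<lambda>i. Y i \<omega>) {..<k}, restrict (\<lambda>i. Y i \<omega>) {k})) -`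
      ({f \<in> space (PiM {..<k} N). Q f} \<times> {f \<in> space (PiM {k} N). f k \<in> B}) \<inter> space M =
      {\<omega> \<in> space M. Q (restrict (\<lambda>i. Y i \<omega>) {..<k}) \<and> Y k \<omega> \<in> B}"
    using past now by auto
  also have "(\<lambda>\<omega>. restrict (\<lambda>i. Y i \<omega>) {..<k}) -` {f \<in> space (PiM {..<k} N). Q f} \<inter> space M =
      {\<omega> \<in> space M. Q (restrict (\<lambda>i. Y i \<omega>) {..<k})}"
    using past by auto
  also have "(\<lambda>\<omega>. restrict (\<lambda>i. Y i \<omega>) {k}) -` {f \<in> space (PiM {k} N). f k \<in> B} \<inter> space M =
      {\<omega> \<in> space M. Y k \<omega> \<in> B}"
    using now by auto
  finally show ?thesis .
qed

section \<open>The coupled path as a birth-death chain\<close>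

definition uniform_sequence :: "(nat \<Rightarrow> real) measure" where
  "uniform_sequence = PiM UNIV (\<lambda>_. uniform_measure lborel {0..1})"

lemma prob_space_uniform: "prob_space (uniform_measure lborel {0..1::real})"
  by (rule prob_space_uniform_measure) auto

lemma prob_space_uniform_sequence: "prob_space uniform_sequence"
  unfolding uniform_sequence_def by (intro prob_space_PiM prob_space_uniform)

lemma level_measurable:
  assumes "{..<n} \<subseteq> I"
  shows "(\<lambda>u. level c u n) \<in> PiM I (\<lambda>_. uniform_measure lborel {0..1}) \<rightarrow>\<^sub>M count_space UNIV"
  using assms
proof (induction n)
  case (Suc n)
  have "{..<n} \<subseteq> I" and n: "n \<in> I"
    using Suc.prems by auto
  note [measurable] = Suc.IH[OF this(1)]
  have [measurable]: "(\<lambda>u. u n) \<in> borel_measurable (PiM I (\<lambda>_. uniform_measure lborel {0..1::real}))"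
    using measurable_component_singleton[OF n, of "\<lambda>_. uniform_measure lborel {0..1::real}"]
    by (simp cong: measurable_cong_sets)
  have [measurable]: "(\<lambda>u. rise c (excess n (level c u n)))
      \<in> borel_measurable (PiM I (\<lambda>_. uniform_measure lborel {0..1}))"
    by (rule measurable_compose[OF Suc.IH[OF \<open>{..<n} \<subseteq> I\<close>]]) simp
  show ?case
    unfolding level.simps by measurable
qed simp

lemma level_restrict: "i \<le> n \<Longrightarrow> level c (restrict u {..<n}) i = level c u i"
proof (induction i)
  case (Suc i)
  have "level c (restrict u {..<n}) i = level c u i"
    by (rule Suc.IH) (use Suc.prems in simp)
  moreover have "restrict u {..<n} i = u i"
    using Suc.prems by simp
  ultimately show ?case by (simp only: level.simps)
qed simp

text \<open>The path up to time \<open>n\<close> is a function of \<open>u 0, ..., u (n - 1)\<close>, hence independent of the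
  number \<open>u n\<close> that decides about the next move.\<close>

lemma level_chain:
  assumes c: "0 \<le> c" "c \<le> 1 / 4"
  shows "birth_death_chain uniform_sequence (\<lambda>n j. rise c (excess n j)) (\<lambda>n u. level c u n)"
proof -
  let ?U = "uniform_measure lborel {0..1::real}"
  interpret U: prob_space ?U by (rule prob_space_uniform)
  interpret prob_space uniform_sequence by (rule prob_space_uniform_sequence)
  have comp[measurable]: "(\<lambda>u. u i) \<in> uniform_sequence \<rightarrow>\<^sub>M ?U" for i
    unfolding uniform_sequence_def by (rule measurable_component_singleton) simp
  have marginal: "distr uniform_sequence ?U (\<lambda>u. u i) = ?U" for i
    unfolding uniform_sequence_def by (rule distr_PiM_component) (auto simp: prob_space_uniform)
  have indep: "indep_vars (\<lambda>_. ?U) (\<lambda>i u. u i) (UNIV :: nat set)"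
    by (subst indep_vars_iff_distr_eq_PiM')
       (simp_all add: marginal, simp add: uniform_sequence_def restrict_UNIV distr_id)
  have below: "prob {u \<in> space uniform_sequence. u n \<in> {..<t}} = t" if "0 \<le> t" "t \<le> 1" for n t
  proof -
    have "prob {u \<in> space uniform_sequence. u n \<in> {..<t}} = measure (distr uniform_sequence ?U (\<lambda>u. u n)) {..<t}"
      by (subst measure_distr) (auto intro!: arg_cong[where f=prob])
    also have "\<dots> = measure lborel ({0..1} \<inter> {..<t})"
      unfolding marginal by (subst measure_uniform_measure) auto
    also have "{0..1} \<inter> {..<t} = {0..<t}"
      using that by auto
    finally show ?thesis using that by simp
  qed
  show ?thesis
  proof
    show [measurable]: "(\<lambda>u. level c u n) \<in> uniform_sequence \<rightarrow>\<^sub>M count_space UNIV" for n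
      unfolding uniform_sequence_def by (rule level_measurable) simp
    show "prob {u \<in> space uniform_sequence. (\<forall>i\<le>n. level c u i = l i) \<and> level c u (Suc n) = Suc (l n)} =
        rise c (excess n (l n)) * prob {u \<in> space uniform_sequence. \<forall>i\<le>n. level c u i = l i}" for n l
    proof -
      let ?t = "rise c (excess n (l n))"
      let ?Q = "\<lambda>f. \<forall>i\<le>n. level c f i = l i"
      have Q: "?Q (restrict u {..<n}) \<longleftrightarrow> ?Q u" for u
        by (simp add: level_restrict)
      have "Measurable.pred (PiM {..<n} (\<lambda>_. ?U)) (\<lambda>f. level c f i = l i)" if "i \<in> {..n}" for i
        by (rule measurable_compose[OF level_measurable]) (use that in auto)
      then have "Measurable.pred (PiM {..<n} (\<lambda>_. ?U)) (\<lambda>f. \<forall>i\<in>{..n}. level c f i = l i)"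
        by (rule pred_intros_finite[rotated]) simp_all
      then have mQ: "Measurable.pred (PiM {..<n} (\<lambda>_. ?U)) ?Q"
        by (simp only: atMost_iff Ball_def)
      have step: "?Q u \<and> level c u (Suc n) = Suc (l n) \<longleftrightarrow> ?Q u \<and> u n \<in> {..<?t}" for u
      proof (rule conj_cong[OF refl])
        assume "?Q u"
        then have "level c u n = l n" by blast
        then show "level c u (Suc n) = Suc (l n) \<longleftrightarrow> u n \<in> {..<?t}" by simp linarith
      qed
      have t: "prob {u \<in> space uniform_sequence. u n \<in> {..<?t}} = ?t"
        by (rule below) (use rise_bounds[OF c, of "excess n (l n)"] in auto)
      have "{..<?t} \<in> sets ?U" by simp
      from prob_past_and_next[OF indep mQ this]
      have "prob {u \<in> space uniform_sequence. ?Q u \<and> u n \<in> {..<?t}} =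
          prob {u \<in> space uniform_sequence. ?Q u} * ?t"
        by (simp only: t Q UNIV_I)
      then show ?thesis
        by (simp only: step mult.commute)
    qed
  qed auto
qed

section \<open>The walk with its sign as a function of coin tosses\<close>

text \<open>The pair \<open>(j, s)\<close> stands for the position \<open>2 * j + 1\<close> of the walk (if \<open>s\<close>) or
  \<open>- (2 * j + 1)\<close> (if \<open>\<not> s\<close>). The toss \<open>b 0\<close> is the sign of the start and \<open>b n\<close>, for
  positive \<open>n\<close>, is the direction of the \<open>n\<close>th step: a step in the direction of the sign
  increases \<open>j\<close>, a step against it decreases \<open>j\<close> or, from \<open>j = 0\<close>, changes the sign.\<close>

fun signed_level :: "(nat \<Rightarrow> bool) \<Rightarrow> nat \<Rightarrow> nat \<times> bool" where
  "signed_level b 0 = (0, b 0)"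
| "signed_level b (Suc n) = (case signed_level b n of (j, s) \<Rightarrow>
     if b (Suc n) = s then (Suc j, s) else if j = 0 then (0, \<not> s) else (j - 1, s))"

lemma signed_level_measurable:
  assumes "{..n} \<subseteq> I"
  shows "(\<lambda>b. signed_level b n) \<in> PiM I (\<lambda>_. count_space UNIV) \<rightarrow>\<^sub>M count_space UNIV"
  using assms
proof (induction n)
  case 0
  then have [measurable]: "(\<lambda>b. b 0) \<in> PiM I (\<lambda>_. count_space UNIV) \<rightarrow>\<^sub>M count_space (UNIV :: bool set)"
    by (intro measurable_component_singleton) auto
  show ?case by simp
next
  case (Suc n)
  then have [measurable]: "(\<lambda>b. signed_level b n) \<in> PiM I (\<lambda>_. count_space UNIV) \<rightarrow>\<^sub>M count_space UNIV"
    by (simp add: atMost_Suc)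
  have [measurable]: "(\<lambda>b. b (Suc n)) \<in> PiM I (\<lambda>_. count_space UNIV) \<rightarrow>\<^sub>M count_space (UNIV :: bool set)"
    using Suc.prems by (intro measurable_component_singleton) auto
  let ?step = "\<lambda>x c. case x of (j, s) \<Rightarrow>
    if c = s then (Suc j, s) else if j = 0 then (0, \<not> s) else (j - 1, s)"
  have "(\<lambda>b. ?step x (b (Suc n))) \<in> PiM I (\<lambda>_. count_space UNIV) \<rightarrow>\<^sub>M count_space UNIV" for x
    by (rule measurable_compose[where N = "count_space UNIV"]) simp_all
  then have "(\<lambda>b. ?step (signed_level b n) (b (Suc n)))
      \<in> PiM I (\<lambda>_. count_space UNIV) \<rightarrow>\<^sub>M count_space UNIV"
    by (rule measurable_compose_countable) fact
  then show ?case by (simp only: signed_level.simps)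
qed

lemma signed_level_restrict: "i \<le> n \<Longrightarrow> signed_level (restrict b {..<Suc n}) i = signed_level b i"
proof (induction i)
  case (Suc i)
  have "signed_level (restrict b {..<Suc n}) i = signed_level b i"
    by (rule Suc.IH) (use Suc.prems in simp)
  moreover have "restrict b {..<Suc n} (Suc i) = b (Suc i)"
    using Suc.prems by simp
  ultimately show ?case by (simp only: signed_level.simps)
qed simp

lemma sum_steps_signed_level:
  assumes "\<And>i. x i = (if b i then 1 else - 1 :: real)"
  shows "x 0 + 2 * (\<Sum>k = 1..n. x k) =
    (if snd (signed_level b n) then 1 else - 1) * (2 * real (fst (signed_level b n)) + 1)"
proof (induction n)
  case (Suc n)
  obtain j s where "signed_level b n = (j, s)"
    by (cases "signed_level b n")
  note js = this
  have "x 0 + 2 * (\<Sum>k = 1..Suc n. x k) = (x 0 + 2 * (\<Sum>k = 1..n. x k)) + 2 * x (Suc n)"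
    by simp
  also have "\<dots> = (if s then 1 else - 1) * (2 * real j + 1) + 2 * (if b (Suc n) then 1 else - 1)"
    unfolding Suc.IH js assms[of "Suc n"] by simp
  finally show ?case
    using js by (cases j; cases s; cases "b (Suc n)") simp_all
qed (simp add: assms[of 0])

section \<open>The level of the walk as a birth-death chain\<close>

lemma excess_up: "excess (Suc n) (Suc j) = Suc (excess n j)"
  by (simp add: excess_def)

lemma excess_down: "j > 0 \<Longrightarrow> Suc (excess (Suc n) (j - 1)) = excess n j"
  by (cases j) (simp_all add: excess_def)

lemma excess_reflect: "excess (Suc n) 0 = 1 - excess n 0" "excess n 0 \<le> 1"
  by (simp_all add: excess_def mod_Suc)

lemma all_le_Suc_split: "(\<forall>i\<le>Suc n. P i) \<longleftrightarrow> (\<forall>i\<le>n. P i) \<and> P (Suc n)"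
  by (auto simp: le_Suc_eq)

locale coin_sequence = prob_space M for M :: "'a measure" +
  fixes p :: real and b :: "'a \<Rightarrow> nat \<Rightarrow> bool"
  assumes p: "0 \<le> p" "p \<le> 1"
    and coins_indep: "indep_vars (\<lambda>_. count_space UNIV) (\<lambda>i \<omega>. b \<omega> i) UNIV"
    and coin_start: "prob {\<omega> \<in> space M. b \<omega> 0} = 1 / 2"
    and coin_step: "\<And>n. prob {\<omega> \<in> space M. b \<omega> (Suc n)} = p"
begin

definition face :: "bool \<Rightarrow> real" where "face s = (if s then p else 1 - p)"

lemma coin_measurable [measurable]: "(\<lambda>\<omega>. b \<omega> i) \<in> M \<rightarrow>\<^sub>M count_space UNIV"
  using coins_indep by (auto simp: indep_vars_def)

lemma prob_coin: "prob {\<omega> \<in> space M. b \<omega> 0 = s} = 1 / 2" "prob {\<omega> \<in> space M. b \<omega> (Suc n) = s} = face s"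
proof -
  have compl: "prob {\<omega> \<in> space M. \<not> b \<omega> i} = 1 - prob {\<omega> \<in> space M. b \<omega> i}" for i
    by (rule prob_neg) measurable
  show "prob {\<omega> \<in> space M. b \<omega> 0 = s} = 1 / 2"
    by (cases s) (simp_all add: coin_start compl)
  show "prob {\<omega> \<in> space M. b \<omega> (Suc n) = s} = face s"
    by (cases s) (simp_all add: coin_step compl face_def)
qed

lemma signed_level_measurable_coins [measurable]:
  "(\<lambda>\<omega>. signed_level (b \<omega>) n) \<in> M \<rightarrow>\<^sub>M count_space UNIV"
proof (rule measurable_compose[OF _ signed_level_measurable[of n UNIV]])
  show "b \<in> M \<rightarrow>\<^sub>M PiM UNIV (\<lambda>_. count_space UNIV)"
    by (rule measurable_PiM_single') auto
qed simp

definition signed_path :: "nat \<Rightarrow> (nat \<Rightarrow> nat) \<Rightarrow> bool \<Rightarrow> 'a set" where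
  "signed_path n l s = {\<omega> \<in> space M. (\<forall>i\<le>n. fst (signed_level (b \<omega>) i) = l i) \<and> snd (signed_level (b \<omega>) n) = s}"

lemma signed_path_event [measurable]: "signed_path n l s \<in> events"
proof -
  have "Measurable.pred M (\<lambda>\<omega>. fst (signed_level (b \<omega>) i) = l i)" for i
    by (rule measurable_compose[OF signed_level_measurable_coins]) simp
  then have "Measurable.pred M (\<lambda>\<omega>. \<forall>i\<in>{..n}. fst (signed_level (b \<omega>) i) = l i)"
    by (rule pred_intros_finite[rotated]) simp
  moreover have "Measurable.pred M (\<lambda>\<omega>. snd (signed_level (b \<omega>) n) = s)"
    by (rule measurable_compose[OF signed_level_measurable_coins]) simp
  ultimately have "Measurable.pred M
      (\<lambda>\<omega>. (\<forall>i\<in>{..n}. fst (signed_level (b \<omega>) i) = l i) \<and> snd (signed_level (b \<omega>) n) = s)"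
    by (rule pred_intros_logic)
  then show ?thesis
    unfolding signed_path_def by (simp only: pred_def atMost_iff Ball_def)
qed

lemma prob_signed_path_and_next:
  "prob {\<omega> \<in> signed_path n l s. b \<omega> (Suc n) = c} = prob (signed_path n l s) * face c"
proof -
  let ?Q = "\<lambda>f. (\<forall>i\<le>n. fst (signed_level f i) = l i) \<and> snd (signed_level f n) = s"
  have Q: "?Q (restrict (\<lambda>i. b \<omega> i) {..<Suc n}) \<longleftrightarrow> ?Q (b \<omega>)" for \<omega>
    by (simp add: signed_level_restrict)
  have m: "(\<lambda>f. signed_level f i) \<in> PiM {..<Suc n} (\<lambda>_. count_space UNIV) \<rightarrow>\<^sub>M count_space UNIV" if "i \<le> n" for i
    by (rule signed_level_measurable) (use that in auto)
  have "Measurable.pred (PiM {..<Suc n} (\<lambda>_. count_space UNIV)) (\<lambda>f. fst (signed_level f i) = l i)"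
    if "i \<in> {..n}" for i
    by (rule measurable_compose[OF m]) (use that in auto)
  then have "Measurable.pred (PiM {..<Suc n} (\<lambda>_. count_space UNIV)) (\<lambda>f. \<forall>i\<in>{..n}. fst (signed_level f i) = l i)"
    by (rule pred_intros_finite[rotated]) simp_all
  moreover have "Measurable.pred (PiM {..<Suc n} (\<lambda>_. count_space UNIV)) (\<lambda>f. snd (signed_level f n) = s)"
    by (rule measurable_compose[OF m]) auto
  ultimately have "Measurable.pred (PiM {..<Suc n} (\<lambda>_. count_space UNIV))
      (\<lambda>f. (\<forall>i\<in>{..n}. fst (signed_level f i) = l i) \<and> snd (signed_level f n) = s)"
    by (rule pred_intros_logic)
  then have mQ: "Measurable.pred (PiM {..<Suc n} (\<lambda>_. count_space UNIV)) ?Q"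
    by (simp only: atMost_iff Ball_def)
  have "{c} \<in> sets (count_space UNIV)" by simp
  from prob_past_and_next[OF coins_indep mQ this]
  have "prob {\<omega> \<in> space M. ?Q (b \<omega>) \<and> b \<omega> (Suc n) = c} = prob {\<omega> \<in> space M. ?Q (b \<omega>)} * face c"
    by (simp only: Q singleton_iff prob_coin)
  then show ?thesis
    unfolding signed_path_def by (simp add: conj_assoc)
qed

text \<open>Given the levels, the last sign determines the last toss and the previous sign.\<close>

lemma signed_path_Suc:
  "signed_path (Suc n) l s =
    (if l (Suc n) = Suc (l n) then {\<omega> \<in> signed_path n l s. b \<omega> (Suc n) = s}
     else if l n > 0 \<and> l (Suc n) = l n - 1 then {\<omega> \<in> signed_path n l s. b \<omega> (Suc n) = (\<not> s)}
     else if l n = 0 \<and> l (Suc n) = 0 then {\<omega> \<in> signed_path n l (\<not> s). b \<omega> (Suc n) = s}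
     else {})" (is "_ = ?R")
proof (rule set_eqI)
  fix \<omega>
  have split: "\<omega> \<in> signed_path (Suc n) l s \<longleftrightarrow> \<omega> \<in> space M \<and> (\<forall>i\<le>n. fst (signed_level (b \<omega>) i) = l i) \<and>
      signed_level (b \<omega>) (Suc n) = (l (Suc n), s)"
    unfolding signed_path_def by (simp only: all_le_Suc_split prod_eq_iff mem_Collect_eq fst_conv snd_conv conj_assoc)
  show "\<omega> \<in> signed_path (Suc n) l s \<longleftrightarrow> \<omega> \<in> ?R"
  proof (cases "\<omega> \<in> space M \<and> (\<forall>i\<le>n. fst (signed_level (b \<omega>) i) = l i)")
    case True
    define t where "t = snd (signed_level (b \<omega>) n)"
    have "signed_level (b \<omega>) n = (l n, t)"
      using True by (simp add: t_def prod_eq_iff)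
    then have "signed_level (b \<omega>) (Suc n) =
        (if b \<omega> (Suc n) = t then (Suc (l n), t) else if l n = 0 then (0, \<not> t) else (l n - 1, t))"
      by (simp only: signed_level.simps case_prod_conv)
    then have "\<omega> \<in> signed_path (Suc n) l s \<longleftrightarrow>
        (if b \<omega> (Suc n) = t then (Suc (l n), t) else if l n = 0 then (0, \<not> t) else (l n - 1, t)) = (l (Suc n), s)"
      unfolding split using True by argo
    moreover have "\<omega> \<in> signed_path n l s' \<longleftrightarrow> s' = t" for s'
      using True by (auto simp: signed_path_def t_def)
    ultimately show ?thesis by (cases "l n") auto
  next
    case False
    then have "\<omega> \<notin> signed_path n l s'" for s'
      by (auto simp: signed_path_def)
    with False show ?thesis unfolding split by auto
  qed
qed

text \<open>The heart of the computation. The levels \<open>l 0, ..., l n\<close> leave exactly two possibilities for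
  the walk, which are mirror images of each other. Among the steps of one of them there are
  \<open>g = excess n (l n)\<close> more up-steps than down-steps, among those of the other \<open>g\<close> more
  down-steps than up-steps. Cancelling pairs of an up-step and a down-step, of weight
  \<open>p * (1 - p)\<close> each, leaves the weights \<open>p ^ g\<close> and \<open>(1 - p) ^ g\<close> up to a common factor \<open>w\<close>.
  Impossible sequences of levels have \<open>w = 0\<close>.\<close>

lemma prob_signed_path:
  "\<exists>w. \<forall>s. prob (signed_path n l s) = w * face s ^ excess n (l n)"
proof (induction n)
  case 0
  show ?case
  proof (cases "l 0 = 0")
    case True
    then have "signed_path 0 l s = {\<omega> \<in> space M. b \<omega> 0 = s}" for s
      by (auto simp: signed_path_def)
    with True show ?thesis
      by (intro exI[of _ "1 / 2"]) (simp add: prob_coin excess_def)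
  next
    case False
    then have "signed_path 0 l s = {}" for s
      by (auto simp: signed_path_def)
    then show ?thesis by (intro exI[of _ 0]) simp
  qed
next
  case (Suc n)
  then obtain w where w: "\<And>s. prob (signed_path n l s) = w * face s ^ excess n (l n)" by blast
  have flip: "face s * face (\<not> s) = p * (1 - p)" for s
    by (simp add: face_def)
  consider (up) "l (Suc n) = Suc (l n)" | (down) "l n > 0" "l (Suc n) = l n - 1"
    | (reflect) "l n = 0" "l (Suc n) = 0"
    | (none) "l (Suc n) \<noteq> Suc (l n)" "\<not> (l n > 0 \<and> l (Suc n) = l n - 1)" "\<not> (l n = 0 \<and> l (Suc n) = 0)"
    by argo
  then show ?case
  proof cases
    case up
    then have "prob (signed_path (Suc n) l s) = w * face s ^ excess (Suc n) (l (Suc n))" for s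
      by (simp add: signed_path_Suc prob_signed_path_and_next w excess_up)
    then show ?thesis by blast
  next
    case down
    let ?g = "excess (Suc n) (l (Suc n))"
    have "signed_path (Suc n) l s = {\<omega> \<in> signed_path n l s. b \<omega> (Suc n) = (\<not> s)}" for s
      unfolding signed_path_Suc using down by simp linarith
    then have "prob (signed_path (Suc n) l s) = w * face s ^ excess n (l n) * face (\<not> s)" for s
      by (simp only: prob_signed_path_and_next w)
    moreover have "excess n (l n) = Suc ?g"
      using down excess_down[of "l n" n] by simp
    ultimately have "prob (signed_path (Suc n) l s) = w * (face s * face (\<not> s)) * face s ^ ?g" for s
      by simp
    then show ?thesis unfolding flip by blast
  next
    case reflect
    \<comment> \<open>At level \<open>0\<close> the excess is the parity of the time. A sign change after excess \<open>0\<close> leaves one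
      unpaired step; after excess \<open>1\<close> it completes a pair.\<close>
    have "signed_path (Suc n) l s = {\<omega> \<in> signed_path n l (\<not> s). b \<omega> (Suc n) = s}" for s
      unfolding signed_path_Suc using reflect by simp
    then have P: "prob (signed_path (Suc n) l s) = w * face (\<not> s) ^ excess n 0 * face s" for s
      by (simp only: prob_signed_path_and_next w reflect)
    show ?thesis
    proof (cases "excess n 0 = 0")
      case True
      then have "prob (signed_path (Suc n) l s) = w * face s ^ excess (Suc n) (l (Suc n))" for s
        unfolding P reflect excess_reflect(1) by simp
      then show ?thesis by blast
    next
      case False
      then have e: "excess n 0 = 1" using excess_reflect(2)[of n] by simp
      have "prob (signed_path (Suc n) l s) = w * (face s * face (\<not> s)) * face s ^ excess (Suc n) (l (Suc n))" for s
        unfolding P reflect excess_reflect(1) e by simp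
      then show ?thesis unfolding flip by blast
    qed
  next
    case none
    then have "signed_path (Suc n) l s = {}" for s
      unfolding signed_path_Suc by argo
    then show ?thesis by (intro exI[of _ 0]) simp
  qed
qed

text \<open>Summing over the two signs, the past has probability \<open>w * (p ^ g + (1 - p) ^ g)\<close>. To go up,
  the next toss must agree with the sign, which contributes one more factor to each summand, so
  the conditional probability is a ratio of consecutive power sums and is independent of \<open>w\<close>.\<close>

lemma level_of_coins_chain:
  "birth_death_chain M (\<lambda>n j. rise (p * (1 - p)) (excess n j)) (\<lambda>n \<omega>. fst (signed_level (b \<omega>) n))"
proof
  show "(\<lambda>\<omega>. fst (signed_level (b \<omega>) n)) \<in> M \<rightarrow>\<^sub>M count_space UNIV" for n
    by (rule measurable_compose[OF signed_level_measurable_coins]) simp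
  show "fst (signed_level (b \<omega>) (Suc n)) \<in> {Suc (fst (signed_level (b \<omega>) n)), fst (signed_level (b \<omega>) n) - 1}" for n \<omega>
    by (cases "signed_level (b \<omega>) n") simp
  fix n and l :: "nat \<Rightarrow> nat"
  let ?P = "{\<omega> \<in> space M. \<forall>i\<le>n. fst (signed_level (b \<omega>) i) = l i}"
  let ?l = "l(Suc n := Suc (l n))"
  obtain w where w: "\<And>s. prob (signed_path n l s) = w * face s ^ excess n (l n)"
    using prob_signed_path[of n l] by blast
  have split_sign: "prob {\<omega> \<in> space M. \<forall>i\<le>m. fst (signed_level (b \<omega>) i) = k i} = prob (signed_path m k True) + prob (signed_path m k False)" for m k
  proof -
    have "{\<omega> \<in> space M. \<forall>i\<le>m. fst (signed_level (b \<omega>) i) = k i} = signed_path m k True \<union> signed_path m k False"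
      "signed_path m k True \<inter> signed_path m k False = {}"
      by (auto simp: signed_path_def)
    then show ?thesis by (simp add: finite_measure_Union)
  qed
  have same: "signed_path n ?l s = signed_path n l s" for s
    by (auto simp: signed_path_def)
  have "signed_path (Suc n) ?l s = {\<omega> \<in> signed_path n l s. b \<omega> (Suc n) = s}" for s
    unfolding signed_path_Suc same by simp
  then have up: "prob (signed_path (Suc n) ?l s) = w * face s ^ excess n (l n) * face s" for s
    by (simp only: prob_signed_path_and_next w)
  have "{\<omega> \<in> space M. (\<forall>i\<le>n. fst (signed_level (b \<omega>) i) = l i) \<and> fst (signed_level (b \<omega>) (Suc n)) = Suc (l n)}
      = {\<omega> \<in> space M. \<forall>i\<le>Suc n. fst (signed_level (b \<omega>) i) = ?l i}"
    by (simp add: all_le_Suc_split del: signed_level.simps)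
  also have "prob \<dots> = w * (p ^ Suc (excess n (l n)) + (1 - p) ^ Suc (excess n (l n)))"
    unfolding split_sign up by (simp add: face_def distrib_left)
  also have "\<dots> = w * (rise (p * (1 - p)) (excess n (l n)) * (p ^ excess n (l n) + (1 - p) ^ excess n (l n)))"
    by (simp only: rise_power_sum[OF p])
  also have "\<dots> = rise (p * (1 - p)) (excess n (l n)) * prob ?P"
    unfolding split_sign w by (simp add: face_def distrib_left)
  finally show "prob {\<omega> \<in> space M. (\<forall>i\<le>n. fst (signed_level (b \<omega>) i) = l i) \<and> fst (signed_level (b \<omega>) (Suc n)) = Suc (l n)} =
      rise (p * (1 - p)) (excess n (l n)) * prob ?P" .
qed simp

end

section \<open>Application to the walk\<close>

context signed_steps
begin

definition draw :: "nat \<Rightarrow> 'a \<Rightarrow> real" where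
  "draw i = (if i = 0 then X0 else X i)"

lemma steps_measurable: "n \<ge> 1 \<Longrightarrow> X n \<in> borel_measurable M"
  using indep_steps by (auto simp: indep_vars_def)

lemma draw_measurable [measurable]: "draw i \<in> borel_measurable M"
  using steps_measurable[of i] start_measurable by (simp add: draw_def)

text \<open>An intersection of events about the steps belongs to the \<open>\<sigma>\<close>-algebra generated by the
  whole sequence of steps, so the event about the start splits off as a factor; the
  remaining factors come from the independence of the steps.\<close>

lemma draw_indep: "indep_vars (\<lambda>_. borel) draw UNIV"
  unfolding indep_vars_def2
proof (intro conjI ballI indep_setsI)
  fix A and J :: "nat set"
  assume J: "J \<noteq> {}" "J \<subseteq> UNIV" "finite J"
    and "\<forall>j\<in>J. A j \<in> {draw j -` A \<inter> space M |A. A \<in> sets borel}"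
  then have "\<exists>C. \<forall>j\<in>J. A j = draw j -` C j \<inter> space M \<and> C j \<in> sets borel"
    by (intro bchoice) auto
  then obtain C where A: "\<And>j. j \<in> J \<Longrightarrow> A j = draw j -` C j \<inter> space M"
    and C: "\<And>j. j \<in> J \<Longrightarrow> C j \<in> sets borel" by blast
  let ?K = "J - {0}"
  have later: "prob (\<Inter>j\<in>?K. A j) = (\<Prod>j\<in>?K. prob (A j))" if "?K \<noteq> {}"
  proof -
    have A_eq: "A j = X j -` C j \<inter> space M" if "j \<in> ?K" for j
      using that A by (simp add: draw_def)
    then have "(\<Inter>j\<in>?K. A j) = (\<Inter>j\<in>?K. X j -` C j \<inter> space M)"
      by (intro INF_cong refl)
    moreover have "(\<Prod>j\<in>?K. prob (A j)) = (\<Prod>j\<in>?K. prob (X j -` C j \<inter> space M))"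
      using A_eq by (intro prod.cong refl) simp
    moreover have "prob (\<Inter>j\<in>?K. X j -` C j \<inter> space M) = (\<Prod>j\<in>?K. prob (X j -` C j \<inter> space M))"
      by (rule indep_varsD[OF indep_steps \<open>?K \<noteq> {}\<close>]) (use J C in auto)
    ultimately show ?thesis by simp
  qed
  show "prob (\<Inter>j\<in>J. A j) = (\<Prod>j\<in>J. prob (A j))"
  proof (cases "0 \<in> J \<and> ?K \<noteq> {}")
    case False
    then consider "J = ?K" "?K \<noteq> {}" | "J = {0}"
      using J by fastforce
    then show ?thesis using later by cases simp_all
  next
    case True
    have "A 0 \<in> sets (vimage_algebra (space M) X0 borel)"
      using A[of 0] C[of 0] True by (auto simp: draw_def intro!: in_vimage_algebra)
    moreover have "(\<Inter>j\<in>?K. A j) \<in> sets (vimage_algebra (space M) (\<lambda>\<omega> n. X (Suc n) \<omega>) borel)"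
    proof (intro sets.finite_INT)
      fix j assume j: "j \<in> ?K"
      then obtain i where i: "j = Suc i" by (cases j) auto
      have "(\<lambda>f. f i) \<in> borel_measurable (borel :: (nat \<Rightarrow> real) measure)"
        by (rule measurable_product_coordinates)
      from measurable_sets[OF this, of "C j"] C[of j] j
      have "(\<lambda>f. f i) -` C j \<in> sets (borel :: (nat \<Rightarrow> real) measure)"
        by simp
      moreover have "A j = (\<lambda>\<omega> n. X (Suc n) \<omega>) -` ((\<lambda>f. f i) -` C j) \<inter> space M"
        using A[of j] j i by (auto simp: draw_def)
      ultimately show "A j \<in> sets (vimage_algebra (space M) (\<lambda>\<omega> n. X (Suc n) \<omega>) borel)"
        by (simp add: in_vimage_algebra)
    qed (use J True in auto)
    ultimately have "prob (A 0 \<inter> (\<Inter>j\<in>?K. A j)) = prob (A 0) * prob (\<Inter>j\<in>?K. A j)"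
      by (rule indep_setD[OF indep_start])
    moreover have "A 0 \<inter> (\<Inter>j\<in>?K. A j) = (\<Inter>j\<in>J. A j)"
      using True by blast
    moreover have "(\<Prod>j\<in>J. prob (A j)) = prob (A 0) * (\<Prod>j\<in>?K. prob (A j))"
      using True J by (intro prod.remove) auto
    ultimately show ?thesis using later True by simp
  qed
qed auto

lemma coins: "coin_sequence M p (\<lambda>\<omega> i. draw i \<omega> = 1)"
proof
  show "0 \<le> p"
    using step_up[of 1] measure_nonneg[of M "{\<omega> \<in> space M. X 1 \<omega> = 1}"] by simp
  show "p \<le> 1"
    using step_down[of 1] measure_nonneg[of M "{\<omega> \<in> space M. X 1 \<omega> = -1}"] by simp
  show "indep_vars (\<lambda>_. count_space UNIV) (\<lambda>i \<omega>. draw i \<omega> = 1) UNIV"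
    by (rule indep_vars_compose2[OF draw_indep]) simp
qed (use step_up start_up in \<open>simp_all add: draw_def\<close>)

lemma draw_sign_AE: "AE \<omega> in M. \<forall>i. draw i \<omega> = (if draw i \<omega> = 1 then 1 else - 1)"
  unfolding AE_all_countable
proof
  fix i
  have ev: "{\<omega> \<in> space M. draw i \<omega> = c} \<in> events" for c
    by measurable
  have "prob {\<omega> \<in> space M. draw i \<omega> = 1} + prob {\<omega> \<in> space M. draw i \<omega> = -1} = 1"
    using step_up[of i] step_down[of i] start_up start_down by (cases "i = 0") (simp_all add: draw_def)
  moreover have "prob ({\<omega> \<in> space M. draw i \<omega> = 1} \<union> {\<omega> \<in> space M. draw i \<omega> = -1}) =
      prob {\<omega> \<in> space M. draw i \<omega> = 1} + prob {\<omega> \<in> space M. draw i \<omega> = -1}"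
    by (rule finite_measure_Union[OF ev ev]) auto
  ultimately have "prob ({\<omega> \<in> space M. draw i \<omega> = 1} \<union> {\<omega> \<in> space M. draw i \<omega> = -1}) = 1"
    by simp
  then have "AE \<omega> in M. \<omega> \<in> {\<omega> \<in> space M. draw i \<omega> = 1} \<union> {\<omega> \<in> space M. draw i \<omega> = -1}"
    by (rule AE_prob_1)
  then show "AE \<omega> in M. draw i \<omega> = (if draw i \<omega> = 1 then 1 else - 1)"
    by eventually_elim auto
qed

lemma abs_walk_AE:
  "AE \<omega> in M. abs_walk X0 X \<omega> = (\<lambda>n. 2 * real (fst (signed_level (\<lambda>i. draw i \<omega> = 1) n)) + 1)"
  using draw_sign_AE
proof eventually_elim
  fix \<omega> assume sign: "\<forall>i. draw i \<omega> = (if draw i \<omega> = 1 then 1 else - 1)"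
  show "abs_walk X0 X \<omega> = (\<lambda>n. 2 * real (fst (signed_level (\<lambda>i. draw i \<omega> = 1) n)) + 1)"
  proof
    fix n
    have "walk X0 X n \<omega> = draw 0 \<omega> + 2 * (\<Sum>k = 1..n. draw k \<omega>)"
      unfolding walk_def by (simp add: draw_def)
    also have "\<dots> = (if snd (signed_level (\<lambda>i. draw i \<omega> = 1) n) then 1 else - 1) *
        (2 * real (fst (signed_level (\<lambda>i. draw i \<omega> = 1) n)) + 1)"
      by (rule sum_steps_signed_level) (use sign in blast)
    finally show "abs_walk X0 X \<omega> n = 2 * real (fst (signed_level (\<lambda>i. draw i \<omega> = 1) n)) + 1"
      unfolding abs_walk_def by (simp add: abs_mult)
  qed
qed

lemma abs_walk_measurable: "abs_walk X0 X \<in> borel_measurable M"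
proof (rule measurable_coordinatewise_then_product)
  fix n
  have "(\<lambda>\<omega>. \<bar>draw 0 \<omega> + 2 * (\<Sum>k = 1..n. draw k \<omega>)\<bar>) \<in> borel_measurable M"
    by measurable
  also have "(\<lambda>\<omega>. \<bar>draw 0 \<omega> + 2 * (\<Sum>k = 1..n. draw k \<omega>)\<bar>) = (\<lambda>\<omega>. abs_walk X0 X \<omega> n)"
    unfolding abs_walk_def walk_def by (simp add: draw_def)
  finally show "(\<lambda>\<omega>. abs_walk X0 X \<omega> n) \<in> borel_measurable M" .
qed

text \<open>Both sides depend only on the law of a birth-death chain with the same transition
  probabilities.\<close>

lemma integral_abs_walk:
  fixes f :: "(nat \<Rightarrow> real) \<Rightarrow> real"
  assumes f: "f \<in> borel_measurable borel"
  shows "(\<integral>\<omega>. f (abs_walk X0 X \<omega>) \<partial>M) =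
    (\<integral>u. f (\<lambda>n. 2 * real (level (p * (1 - p)) u n) + 1) \<partial>uniform_sequence)"
proof -
  let ?c = "p * (1 - p)" and ?P = "PiM UNIV (\<lambda>_::nat. count_space (UNIV :: nat set))"
  let ?Z = "\<lambda>\<omega> n. fst (signed_level (\<lambda>i. draw i \<omega> = 1) n)"
  let ?h = "\<lambda>z n. 2 * real (z n) + 1"
  interpret coin_sequence M p "\<lambda>\<omega> i. draw i \<omega> = 1" by (rule coins)
  interpret Z: birth_death_chain M "\<lambda>n j. rise ?c (excess n j)" "\<lambda>n \<omega>. ?Z \<omega> n"
    by (rule level_of_coins_chain)
  have c: "0 \<le> ?c" "?c \<le> 1 / 4"
    by (rule up_down_product_bounds[OF p])+
  interpret L: birth_death_chain uniform_sequence "\<lambda>n j. rise ?c (excess n j)" "\<lambda>n u. level ?c u n"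
    by (rule level_chain[OF c])
  have coord: "(\<lambda>z. z n) \<in> ?P \<rightarrow>\<^sub>M count_space UNIV" for n
    by (rule measurable_component_singleton) simp
  have "?h \<in> borel_measurable ?P"
    by (rule measurable_coordinatewise_then_product) (rule measurable_compose[OF coord], simp)
  then have fh: "(\<lambda>z. f (?h z)) \<in> borel_measurable ?P"
    using f by (rule measurable_compose)
  have Z: "?Z \<in> M \<rightarrow>\<^sub>M ?P"
    by (rule measurable_PiM_single') (use Z.chain_measurable in auto)
  have L: "level ?c \<in> uniform_sequence \<rightarrow>\<^sub>M ?P"
    by (rule measurable_PiM_single') (use L.chain_measurable in auto)
  have "(\<integral>\<omega>. f (abs_walk X0 X \<omega>) \<partial>M) = (\<integral>\<omega>. f (?h (?Z \<omega>)) \<partial>M)"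
  proof (rule integral_cong_AE)
    show "AE \<omega> in M. f (abs_walk X0 X \<omega>) = f (?h (?Z \<omega>))"
      using abs_walk_AE by eventually_elim simp
    show "(\<lambda>\<omega>. f (abs_walk X0 X \<omega>)) \<in> borel_measurable M"
      by (rule measurable_compose[OF abs_walk_measurable f])
    show "(\<lambda>\<omega>. f (?h (?Z \<omega>))) \<in> borel_measurable M"
      by (rule measurable_compose[OF Z fh])
  qed
  also have "\<dots> = (\<integral>z. f (?h z) \<partial>distr M ?P ?Z)"
    by (rule integral_distr[OF Z fh, symmetric])
  also have "distr M ?P ?Z = distr uniform_sequence ?P (level ?c)"
    by (rule birth_death_chain_law_unique[OF Z.birth_death_chain_axioms L.birth_death_chain_axioms])
  also have "(\<integral>z. f (?h z) \<partial>distr uniform_sequence ?P (level ?c)) = (\<integral>u. f (?h (level ?c u)) \<partial>uniform_sequence)"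
    by (rule integral_distr[OF L fh])
  finally show ?thesis .
qed

end

lemma level_path_measurable: "(\<lambda>u n. 2 * real (level c u n) + 1) \<in> borel_measurable uniform_sequence"
proof (rule measurable_coordinatewise_then_product)
  show "(\<lambda>u. 2 * real (level c u n) + 1) \<in> borel_measurable uniform_sequence" for n
    unfolding uniform_sequence_def by (rule measurable_compose[OF level_measurable]) auto
qed

text \<open>Since \<open>p * (1 - p) = 1 / 4 - (p - 1 / 2)\<^sup>2\<close>, a larger distance from \<open>1 / 2\<close> means a smaller
  product. The coupled paths are then ordered for every \<open>u\<close>, hence so are the values of
  an increasing function of them.\<close>

lemma stoch_le_abs_walk:
  assumes S': "signed_steps M' p' X0' X'" and S'': "signed_steps M'' p'' X0'' X''"
    and further: "\<bar>p'' - 1 / 2\<bar> \<le> \<bar>p' - 1 / 2\<bar>"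
  shows "stoch_le M'' (abs_walk X0'' X'') M' (abs_walk X0' X')"
proof -
  interpret S': signed_steps M' p' X0' X' by (rule S')
  interpret S'': signed_steps M'' p'' X0'' X'' by (rule S'')
  interpret C': coin_sequence M' p' "\<lambda>\<omega> i. S'.draw i \<omega> = 1" by (rule S'.coins)
  interpret U: prob_space uniform_sequence by (rule prob_space_uniform_sequence)
  interpret C'': coin_sequence M'' p'' "\<lambda>\<omega> i. S''.draw i \<omega> = 1" by (rule S''.coins)
  let ?c' = "p' * (1 - p')" and ?c'' = "p'' * (1 - p'')"
  have "(p'' - 1 / 2)\<^sup>2 \<le> (p' - 1 / 2)\<^sup>2"
    using further by (simp add: abs_le_square_iff)
  then have "?c' \<le> ?c''"
    by (simp add: power2_eq_square algebra_simps)
  then have c: "0 \<le> ?c'" "?c' \<le> ?c''" "?c'' \<le> 1 / 4"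
    using up_down_product_bounds[OF C'.p] up_down_product_bounds[OF C''.p] by simp_all
  have "(\<integral>\<omega>. f (abs_walk X0'' X'' \<omega>) \<partial>M'') \<le> (\<integral>\<omega>. f (abs_walk X0' X' \<omega>) \<partial>M')"
    if f: "f \<in> borel_measurable borel" "bounded (range f)" "mono f" for f :: "(nat \<Rightarrow> real) \<Rightarrow> real"
  proof -
    obtain B where B: "\<And>x. \<bar>f x\<bar> \<le> B"
      using f(2) by (auto simp: bounded_iff)
    have int: "integrable uniform_sequence (\<lambda>u. f (\<lambda>n. 2 * real (level c u n) + 1))" for c
      by (rule U.integrable_const_bound[where B = B])
         (use B measurable_compose[OF level_path_measurable f(1)] in auto)
    have "f (\<lambda>n. 2 * real (level ?c'' u n) + 1) \<le> f (\<lambda>n. 2 * real (level ?c' u n) + 1)" for u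
      using level_antimono[OF c] by (intro monoD[OF f(3)]) (simp add: le_fun_def)
    then show ?thesis
      unfolding S'.integral_abs_walk[OF f(1)] S''.integral_abs_walk[OF f(1)]
      by (intro integral_mono int)
  qed
  then show ?thesis
    unfolding stoch_le_def
    using S'.prob_space_axioms S''.prob_space_axioms S'.abs_walk_measurable S''.abs_walk_measurable by blast
qed

theorem theorem3:
  fixes M' :: "'a measure" and M'' :: "'b measure"
    and p' p'' :: real
    and X0' :: "'a \<Rightarrow> real" and X' :: "nat \<Rightarrow> 'a \<Rightarrow> real"
    and X0'' :: "'b \<Rightarrow> real" and X'' :: "nat \<Rightarrow> 'b \<Rightarrow> real"
  assumes "p' \<in> {0..1}" and "p'' \<in> {0..1}"
    and "signed_steps M' p' X0' X'" and "signed_steps M'' p'' X0'' X''"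
  shows "(\<bar>p' - 1 / 2\<bar> > \<bar>p'' - 1 / 2\<bar> \<longrightarrow>
            stoch_le M'' (abs_walk X0'' X'') M' (abs_walk X0' X')) \<and>
         (p' \<in> {0..1/2} \<and> p'' \<in> {0..1/2} \<and> p' \<le> p'' \<longrightarrow>
            stoch_le M'' (abs_walk X0'' X'') M' (abs_walk X0' X')) \<and>
         (p' \<in> {1/2..1} \<and> p'' \<in> {1/2..1} \<and> p'' \<le> p' \<longrightarrow>
            stoch_le M'' (abs_walk X0'' X'') M' (abs_walk X0' X'))"
  by (intro conjI impI; rule stoch_le_abs_walk[OF assms(3,4)]) auto

end
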